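(* For every positive integer $N$, \[ \sum_{\substack{\pi\in\mathcal{P}_{2,4}\\ |\pi|=N}} (-1)^{\nu(\pi)} = \begin{cases} 1, & \text{if $N$ is odd and $(2j)^2<N<(2j+1)^2$ for some integer $j\ge 1$},\\ -1, & \text{if $N$ is even and $(2j-1)^2<N<(2j)^2$ for some integer $j\ge 1$},\\ 0, & \text{otherwise.} \end{cases} \]
   Context: A partition is a finite non-increasing sequence of positive integers (its parts); $|\pi|$ is the sum of its parts and $\nu(\pi)$ the number of parts counted with multiplicity. $\mathcal{P}_{2,4}$ is the set of non-empty partitions in which every even part size occurs at most once (odd parts may repeat) and whose smallest part is congruent to $2$ modulo $4$. *)

theory Defs
  imports Main
begin

definition is_partition :: "nat list \<Rightarrow> bool" where
  "is_partition p \<longleftrightarrow> sorted_wrt (\<ge>) p \<and> (\<forall>x\<in>set p. 0 < x)"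

text \<open>The size of a partition is \<open>sum_list\<close> and its number of parts (with multiplicity)
  is \<open>length\<close>.\<close>

definition P24 :: "nat list set" where
  "P24 = {p. is_partition p \<and> p \<noteq> []
           \<and> (\<forall>x. even x \<longrightarrow> count_list p x \<le> 1)
           \<and> Min (set p) mod 4 = 2}"

text \<open>The index set of the sum is finite, so that \<open>sum\<close> does not take its default value \<open>0\<close>.\<close>

lemma finite_P24_size: "finite {p \<in> P24. sum_list p = N}"
proof (rule finite_subset)
  show "{p \<in> P24. sum_list p = N} \<subseteq> {p. set p \<subseteq> {..N} \<and> length p \<le> N}"
  proof
    fix p assume p: "p \<in> {p \<in> P24. sum_list p = N}"
    have len: "(\<forall>x\<in>set q. 0 < x) \<Longrightarrow> length q \<le> sum_list q" for q :: "nat list"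
      by (induction q) auto
    from p have "\<forall>x\<in>set p. 0 < x" "sum_list p = N"
      by (auto simp: P24_def is_partition_def)
    with len[of p] show "p \<in> {p. set p \<subseteq> {..N} \<and> length p \<le> N}"
      by (auto dest: member_le_sum_list)
  qed
  show "finite {p. set p \<subseteq> {..N} \<and> length p \<le> N}"
    by (rule finite_lists_length_le) simp
qed

end

(* In generating functions the left-hand side is F = - sum_n q^(4n+2) W(4n+3), where W(k) is the signed
   generating function of the partitions into parts >= k with distinct even parts; removing the part k
   gives W(k) = (1 - q^k) W(k+1) for even k and (1 + q^k) W(k) = W(k+1) for odd k.  Hence F is half the
   difference of the alternating and the plain sum of the series q^(2m) W(2m+1).  The plain sum
   telescopes to 1/(1+q).  The alternating sum L_1 is the member k = 1 of the family
   L_k = sum_m (-1)^m q^(2km) W(2m+1), for which (1 + q^(2k)) L_k = (1 - q^(2k+1)) L_(k+1); iterating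
   this (a case of the q-binomial theorem) yields (1 - q) L_1 = prod_i (1 - q^i)/(1 + q^i).  By Gauss
   this product is theta = sum_(m in Z) (-1)^m q^(m^2), shown here through a finite identity in the style of
   Shanks.  So 2 (1 - q^2) F = (1 + q) theta - (1 - q), and the claimed values satisfy the
   corresponding recurrence.  Infinite sums and products are replaced by truncations that agree
   modulo a power of q. *)

theory Submission
  imports Defs "HOL-Computational_Algebra.Formal_Power_Series" "HOL-Library.Discrete_Functions"
begin

unbundle fps_syntax

subsection \<open>Signed counts of partitions\<close>

definition parts_ge :: "nat \<Rightarrow> nat list set" where
  "parts_ge k = {p. is_partition p \<and> (\<forall>x. even x \<longrightarrow> count_list p x \<le> 1) \<and> (\<forall>x\<in>set p. k \<le> x)}"

definition signed_count :: "nat list set \<Rightarrow> nat \<Rightarrow> int" where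
  "signed_count A N = (\<Sum>p | p \<in> A \<and> sum_list p = N. (-1) ^ length p)"

lemma finite_parts_ge: "finite {p. p \<in> parts_ge k \<and> sum_list p = N}"
proof (rule finite_subset)
  have len: "(\<forall>x\<in>set q. 0 < x) \<Longrightarrow> length q \<le> sum_list q" for q :: "nat list"
    by (induction q) auto
  show "{p. p \<in> parts_ge k \<and> sum_list p = N} \<subseteq> {p. set p \<subseteq> {..N} \<and> length p \<le> N}"
    using len by (auto simp: parts_ge_def is_partition_def dest: member_le_sum_list)
  show "finite {p. set p \<subseteq> {..N} \<and> length p \<le> N}"
    by (rule finite_lists_length_le) simp
qed

text \<open>Parts are non-increasing, so a smallest part sits at the end. An even \<open>k\<close>
  may not recur, which pushes the remaining parts above \<open>k\<close>; an odd \<open>k\<close>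
  may recur.\<close>

lemma parts_ge_snoc_iff:
  assumes "k > 0"
  shows "r @ [k] \<in> parts_ge k \<longleftrightarrow> r \<in> parts_ge (if even k then Suc k else k)"
proof (cases "even k")
  case True
  then show ?thesis using assms
    by (auto simp: parts_ge_def is_partition_def sorted_wrt_append count_list_0_iff le_less
          Suc_le_eq split: if_splits)
next
  case False
  then show ?thesis using assms
    by (auto simp: parts_ge_def is_partition_def sorted_wrt_append)
qed

lemma parts_ge_ends:
  assumes "p \<in> parts_ge k"
  shows "p \<in> parts_ge (Suc k) \<or> (\<exists>r. p = r @ [k])"
proof (cases "k \<in> set p")
  case False
  then show ?thesis using assms by (auto simp: parts_ge_def Suc_le_eq le_less)
next
  case True
  then obtain r x where p: "p = r @ [x]" by (metis empty_iff list.set(1) rev_exhaust)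
  with assms True have "x = k"
    by (auto simp: parts_ge_def is_partition_def sorted_wrt_append le_antisym)
  with p show ?thesis by blast
qed

lemma parts_ge_decompose:
  assumes "k > 0"
  shows "parts_ge k = parts_ge (Suc k) \<union> (\<lambda>r. r @ [k]) ` parts_ge (if even k then Suc k else k)"
    (is "_ = ?A \<union> ?B")
proof
  show "parts_ge k \<subseteq> ?A \<union> ?B"
    using parts_ge_ends parts_ge_snoc_iff[OF assms] by blast
  have "?A \<subseteq> parts_ge k" by (auto simp: parts_ge_def)
  then show "?A \<union> ?B \<subseteq> parts_ge k" using parts_ge_snoc_iff[OF assms] by auto
qed

lemma signed_count_snoc:
  "signed_count ((\<lambda>r. r @ [k]) ` A) N = (if N < k then 0 else - signed_count A (N - k))"
proof -
  have inj: "inj_on (\<lambda>r. r @ [k]) B" for B by (auto simp: inj_on_def)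
  have "{p. p \<in> (\<lambda>r. r @ [k]) ` A \<and> sum_list p = N} =
      (\<lambda>r. r @ [k]) ` {r. r \<in> A \<and> sum_list r + k = N}" by auto
  then have "signed_count ((\<lambda>r. r @ [k]) ` A) N = - (\<Sum>r | r \<in> A \<and> sum_list r + k = N. (-1) ^ length r)"
    by (simp add: signed_count_def sum.reindex[OF inj] o_def sum_negf)
  moreover have "sum_list r + k = N \<longleftrightarrow> \<not> N < k \<and> sum_list r = N - k" for r by auto
  ultimately show ?thesis by (auto simp: signed_count_def)
qed

text \<open>For odd \<open>k\<close> the set \<open>parts_ge k\<close> itself returns on the right,
  at \<open>N - k\<close>; this puts the factor \<open>1 + fps_X ^ k\<close> on the left in
  \<open>W_odd\<close>.\<close>

lemma signed_count_parts_ge: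
  assumes "k > 0"
  shows "signed_count (parts_ge k) N = signed_count (parts_ge (Suc k)) N
    - (if N < k then 0 else signed_count (parts_ge (if even k then Suc k else k)) (N - k))"
proof -
  let ?B = "(\<lambda>r. r @ [k]) ` parts_ge (if even k then Suc k else k)"
  have "{p. p \<in> parts_ge k \<and> sum_list p = N} =
      {p. p \<in> parts_ge (Suc k) \<and> sum_list p = N} \<union> {p. p \<in> ?B \<and> sum_list p = N}"
    using parts_ge_decompose[OF assms] by blast
  moreover have "finite {p. p \<in> ?B \<and> sum_list p = N}"
    by (rule finite_subset[OF _ finite_parts_ge[of k N]]) (use parts_ge_decompose[OF assms] in blast)
  moreover have "{p. p \<in> parts_ge (Suc k) \<and> sum_list p = N} \<inter> {p. p \<in> ?B \<and> sum_list p = N} = {}"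
    by (auto simp: parts_ge_def)
  ultimately have "signed_count (parts_ge k) N = signed_count (parts_ge (Suc k)) N + signed_count ?B N"
    unfolding signed_count_def by (simp add: sum.union_disjoint finite_parts_ge)
  then show ?thesis by (simp add: signed_count_snoc)
qed

lemma signed_count_parts_ge_small:
  assumes "N < k"
  shows "signed_count (parts_ge k) N = (if N = 0 then 1 else 0)"
proof -
  have "p \<in> parts_ge k \<Longrightarrow> sum_list p = N \<Longrightarrow> p = []" for p
    using assms by (cases p) (auto simp: parts_ge_def)
  moreover have "[] \<in> parts_ge k" by (simp add: parts_ge_def is_partition_def)
  ultimately have "p \<in> parts_ge k \<and> sum_list p = N \<longleftrightarrow> p = [] \<and> N = 0" for p
    by (metis sum_list.Nil)
  then show ?thesis by (simp add: signed_count_def)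
qed

text \<open>The smallest part \<open>4 * n + 2\<close> is even, hence occurs once, and its removal
  leaves an arbitrary, possibly empty, partition from \<open>parts_ge (4 * n + 3)\<close>.\<close>

lemma P24_decompose: "P24 = (\<Union>n. (\<lambda>r. r @ [4 * n + 2]) ` parts_ge (4 * n + 3))"
proof (intro set_eqI iffI)
  fix p assume p: "p \<in> P24"
  define k where "k = Min (set p)"
  have ne: "p \<noteq> []" using p by (simp add: P24_def)
  have kp: "k \<in> set p" "\<forall>x\<in>set p. k \<le> x" using ne by (auto simp: k_def)
  have "k mod 4 = 2" using p by (simp add: P24_def k_def)
  then have k: "k = 4 * (k div 4) + 2" "k > 0" "even k" by presburger+
  have pk: "p \<in> parts_ge k" using p kp by (auto simp: P24_def parts_ge_def)
  then obtain r where r: "p = r @ [k]"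
    using parts_ge_ends[OF pk] kp by (auto simp: parts_ge_def)
  then have "r \<in> parts_ge (Suc k)" using pk k parts_ge_snoc_iff[of k r] by simp
  moreover have "Suc k = 4 * (k div 4) + 3" using k by presburger
  ultimately have "r \<in> parts_ge (4 * (k div 4) + 3)" "p = r @ [4 * (k div 4) + 2]"
    using r k(1) by metis+
  then show "p \<in> (\<Union>n. (\<lambda>r. r @ [4 * n + 2]) ` parts_ge (4 * n + 3))" by blast
next
  fix p assume "p \<in> (\<Union>n. (\<lambda>r. r @ [4 * n + 2]) ` parts_ge (4 * n + 3))"
  then obtain n r where p: "p = r @ [4 * n + 2]" and r: "r \<in> parts_ge (4 * n + 3)" by auto
  have "p \<in> parts_ge (4 * n + 2)"
    using parts_ge_snoc_iff[of "4 * n + 2" r] p r by (simp add: numeral_3_eq_3)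
  moreover have "Min (set p) = 4 * n + 2"
    using calculation p by (intro Min_eqI) (auto simp: parts_ge_def)
  moreover have "(4 * n + 2) mod 4 = 2" by presburger
  ultimately show "p \<in> P24" using p by (auto simp: P24_def parts_ge_def)
qed

text \<open>Blocks with \<open>n >= K\<close> contain a part exceeding \<open>N\<close>. Leaving the
  cutoff free lets one finite sum serve all coefficients below \<open>K\<close>.\<close>

lemma signed_count_P24:
  assumes "N < K"
  shows "signed_count P24 N =
    - (\<Sum>n<K. if N < 4 * n + 2 then 0 else signed_count (parts_ge (4 * n + 3)) (N - (4 * n + 2)))"
proof -
  let ?B = "\<lambda>n. {p. p \<in> (\<lambda>r. r @ [4 * n + 2]) ` parts_ge (4 * n + 3) \<and> sum_list p = N}"
  have "n < K" if "p \<in> ?B n" for n p using assms that by auto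
  then have "{p. p \<in> P24 \<and> sum_list p = N} = (\<Union>n<K. ?B n)"
    unfolding P24_decompose by blast
  moreover have "finite (?B n)" for n
    by (rule finite_subset[OF _ finite_P24_size[of N]]) (use P24_decompose in auto)
  ultimately have "signed_count P24 N = (\<Sum>n<K. \<Sum>p\<in>?B n. (-1) ^ length p)"
    unfolding signed_count_def by (subst sum.UNION_disjoint[symmetric]) auto
  also have "\<dots> = (\<Sum>n<K. signed_count ((\<lambda>r. r @ [4 * n + 2]) ` parts_ge (4 * n + 3)) N)"
    by (simp add: signed_count_def)
  finally show ?thesis by (simp add: signed_count_snoc sum_negf[symmetric] if_distrib cong: if_cong)
qed

subsection \<open>Congruence of power series\<close>

text \<open>Divisibility reduces the congruence rules to ring identities. Over the rationals every
  series with non-zero constant term is a unit, which gives \<open>cong_X_cancel\<close>.\<close>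

definition cong_X :: "nat \<Rightarrow> rat fps \<Rightarrow> rat fps \<Rightarrow> bool" where
  "cong_X M f g \<longleftrightarrow> fps_X ^ M dvd f - g"

lemma cong_X_refl: "cong_X M f f" by (simp add: cong_X_def)

lemma cong_X_sym: "cong_X M f g \<Longrightarrow> cong_X M g f"
  by (simp add: cong_X_def dvd_diff_commute)

lemma cong_X_trans [trans]: "cong_X M f g \<Longrightarrow> cong_X M g h \<Longrightarrow> cong_X M f h"
  unfolding cong_X_def by (drule (1) dvd_add) simp

lemma cong_X_diff: "cong_X M f g \<Longrightarrow> cong_X M f' g' \<Longrightarrow> cong_X M (f - f') (g - g')"
  unfolding cong_X_def by (drule (1) dvd_diff) (simp add: algebra_simps)

lemma cong_X_mult: "cong_X M f g \<Longrightarrow> cong_X M f' g' \<Longrightarrow> cong_X M (f * f') (g * g')"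
proof -
  assume "cong_X M f g" "cong_X M f' g'"
  then have "fps_X ^ M dvd (f - g) * f' + g * (f' - g')" by (simp add: cong_X_def)
  then show ?thesis by (simp add: cong_X_def algebra_simps)
qed

lemma cong_X_mono: "cong_X M f g \<Longrightarrow> M' \<le> M \<Longrightarrow> cong_X M' f g"
  unfolding cong_X_def by (meson dvd_trans le_imp_power_dvd)

lemma cong_X_add_multiple: "M \<le> n \<Longrightarrow> cong_X M (f + fps_X ^ n * h) f"
  unfolding cong_X_def by (simp add: dvd_mult2 le_imp_power_dvd)

lemma cong_X_diff_multiple: "M \<le> n \<Longrightarrow> cong_X M (f - fps_X ^ n * h) f"
  unfolding cong_X_def by (simp add: dvd_mult2 le_imp_power_dvd)

lemma cong_X_cancel:
  assumes "cong_X M (u * f) (u * g)" "u $ 0 \<noteq> 0"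
  shows "cong_X M f g"
proof -
  have "cong_X M (inverse u * (u * f)) (inverse u * (u * g))"
    by (intro cong_X_mult cong_X_refl assms)
  then show ?thesis using assms(2) by (simp add: mult.assoc[symmetric] inverse_mult_eq_1)
qed

lemma cong_X_imp_nth_eq:
  assumes "cong_X M f g" "n < M"
  shows "f $ n = g $ n"
proof -
  obtain h where "f - g = fps_X ^ M * h" using assms(1) by (auto simp: cong_X_def)
  then have "(f - g) $ n = 0" using assms(2) by (simp add: fps_X_power_mult_nth)
  then show ?thesis by simp
qed

lemma cong_XI:
  assumes "\<And>n. n < M \<Longrightarrow> f $ n = g $ n"
  shows "cong_X M f g"
proof -
  have "f - g = fps_X ^ M * Abs_fps (\<lambda>n. (f - g) $ (n + M))"
    using assms by (intro fps_ext) (simp add: fps_X_power_mult_nth)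
  then show ?thesis unfolding cong_X_def by (metis dvd_triv_left)
qed

lemma inverse_one_plus_X: "n > 0 \<Longrightarrow> inverse (1 + fps_X ^ n) * (1 + fps_X ^ n) = (1 :: rat fps)"
  by (rule inverse_mult_eq_1) simp

lemma inverse_one_minus_X: "n > 0 \<Longrightarrow> inverse (1 - fps_X ^ n) * (1 - fps_X ^ n) = (1 :: rat fps)"
  by (rule inverse_mult_eq_1) simp

subsection \<open>The theta series as a product\<close>

text \<open>The sum telescopes in both variables: multiplied by \<open>1 + q ^ n\<close>, the increment from
  \<open>n - 1\<close> to \<open>n\<close> is a sum of differences of \<open>a s * q ^ (s * n) * (1 - q ^ s)\<close>.\<close>

lemma shanks_sum:
  fixes q :: "'a :: idom" and a Q :: "nat \<Rightarrow> 'a"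
  assumes a0: "a 0 = 1" and aS: "\<And>s. a (Suc s) * (1 - q ^ Suc s) = - (1 + q ^ s) * a s"
    and Q0: "Q 0 = 1" and QS: "\<And>n. Q (Suc n) * (1 + q ^ Suc n) = Q n * (1 - q ^ Suc n)"
    and nz: "\<And>n. 1 + q ^ Suc n \<noteq> 0"
  shows "Q n * (\<Sum>s\<le>n. a s * q ^ (s * Suc n)) = 1 + 2 * (\<Sum>m=1..n. (-1) ^ m * q ^ (m\<^sup>2))"
proof (induction n)
  case 0
  then show ?case by (simp add: a0 Q0)
next
  case (Suc n)
  define N where "N = Suc n"
  define S where "S = (\<lambda>k. \<Sum>s<N. a s * q ^ (s * k))"
  \<comment> \<open>The two recurrences make this product change sign at each step; the 2 is
    \<open>1 + q ^ 0\<close>. It will supply the new term of the theta sum.\<close>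
  have aQ: "(1 + q ^ m) * Q m * a m = 2 * (-1) ^ m" for m
  proof (induction m)
    case 0
    then show ?case by (simp add: a0 Q0)
  next
    case (Suc m)
    have "(1 + q ^ Suc m) * Q (Suc m) * a (Suc m) = Q m * (a (Suc m) * (1 - q ^ Suc m))"
      using QS[of m] by (metis mult.commute mult.left_commute)
    also have "\<dots> = - ((1 + q ^ m) * Q m * a m)" by (subst aS) (simp add: algebra_simps)
    finally show ?case by (simp add: Suc)
  qed
  have tele: "(1 - q ^ N) * (\<Sum>s<k. a s * q ^ (s * Suc N)) - (1 + q ^ N) * (\<Sum>s<k. a s * q ^ (s * N))
      = a k * q ^ (k * N) * (1 - q ^ k)" for k
  proof (induction k)
    case 0
    then show ?case by simp
  next
    case (Suc k)
    have "a (Suc k) * q ^ (Suc k * N) * (1 - q ^ Suc k) = - (1 + q ^ k) * a k * q ^ (k * N) * q ^ N"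
      using aS[of k] by (simp add: power_add mult_ac)
    moreover have "q ^ (k * Suc N) = q ^ (k * N) * q ^ k"
      by (simp add: power_add mult_ac)
    \<comment> \<open>A polynomial identity in the independent quantities \<open>x = q ^ N\<close>,
      \<open>y = q ^ k\<close>, \<open>z = q ^ (k * N)\<close> and \<open>c = a k\<close>.\<close>
    moreover have "(1 - x) * (A + c * (z * y)) - (1 + x) * (B + c * z) = - (1 + y) * c * z * x"
      if "(1 - x) * A - (1 + x) * B = c * z * (1 - y)" for x y z c A B :: 'a
      using that by algebra
    ultimately show ?case using Suc by (simp only: sum.lessThan_Suc)
  qed
  have sq: "q ^ (N * Suc N) = q ^ (N\<^sup>2) * q ^ N" "q ^ (N * N) = q ^ (N\<^sup>2)"
    by (simp_all add: power_add power2_eq_square mult_ac)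
  have "(1 + q ^ N) * (Q N * (\<Sum>s\<le>N. a s * q ^ (s * Suc N)))
      = Q n * ((1 - q ^ N) * (S (Suc N) + a N * q ^ (N * Suc N)))"
    using QS[of n] by (simp add: S_def N_def[symmetric] lessThan_Suc_atMost[symmetric] mult_ac)
  \<comment> \<open>The boundary term of \<open>tele\<close> at \<open>k = N\<close> and the summand
    \<open>s = N\<close> differ by a factor \<open>q ^ N\<close>. Together they yield the factor
    \<open>1 + q ^ N\<close>, which is cancelled at the end.\<close>
  also have "\<dots> = Q n * ((1 + q ^ N) * S N + a N * q ^ (N\<^sup>2) * (1 - q ^ N) * (1 + q ^ N))"
  proof -
    have "(1 - x) * (A + c * (z * x)) = (1 + x) * B + c * z * (1 - x) * (1 + x)"
      if "(1 - x) * A - (1 + x) * B = c * z * (1 - x)" for x z c A B :: 'a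
      using that by algebra
    from this[OF tele[of N, unfolded sq]] show ?thesis unfolding sq S_def by (rule arg_cong)
  qed
  also have "\<dots> = (1 + q ^ N) * (Q n * S N + q ^ (N\<^sup>2) * ((1 + q ^ N) * Q N * a N))"
  proof -
    have "u * ((1 + x) * B + c * z * (1 - x) * (1 + x)) = (1 + x) * (u * B + z * ((1 + x) * v * c))"
      if "v * (1 + x) = u * (1 - x)" for u v x z c B :: 'a
      using that by algebra
    from this[OF QS[of n, folded N_def]] show ?thesis .
  qed
  finally have "Q N * (\<Sum>s\<le>N. a s * q ^ (s * Suc N)) = Q n * S N + q ^ (N\<^sup>2) * (2 * (-1) ^ N)"
    using nz[of n] unfolding N_def[symmetric] aQ by simp
  moreover have "Q n * S N = 1 + 2 * (\<Sum>m=1..n. (-1) ^ m * q ^ (m\<^sup>2))"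
    using Suc by (simp add: S_def N_def lessThan_Suc_atMost)
  ultimately show ?case by (simp add: N_def algebra_simps)
qed

section \<open>Gauss's product for the theta series, modulo powers of \<open>fps_X\<close>\<close>

definition Q :: "nat \<Rightarrow> rat fps" where
  "Q n = (\<Prod>i<n. (1 - fps_X ^ Suc i) * inverse (1 + fps_X ^ Suc i))"

lemma Q_Suc: "Q (Suc n) = Q n * (1 - fps_X ^ Suc n) * inverse (1 + fps_X ^ Suc n)"
  by (simp add: Q_def mult_ac)

text \<open>The series sum_(m in Z) (-1)^m q^(m^2), with the terms of m and -m merged: hence the 2
  at positive squares.\<close>

definition theta :: "rat fps" where
  "theta = Abs_fps (\<lambda>n. if n = 0 then 1 else
     if (floor_sqrt n)\<^sup>2 = n then 2 * (-1) ^ floor_sqrt n else 0)"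

lemma theta_truncated: "cong_X (Suc n) theta (1 + 2 * (\<Sum>m=1..n. (-1) ^ m * fps_X ^ (m\<^sup>2)))"
proof (rule cong_XI)
  fix k assume k: "k < Suc n"
  have "(\<Sum>m=1..n. (-1) ^ m * fps_X ^ (m\<^sup>2) :: rat fps) $ k =
      (\<Sum>m=1..n. if m\<^sup>2 = k then (-1) ^ m else 0)"
  proof (subst fps_sum_nth, rule sum.cong)
    fix m :: nat
    have "((-1) ^ m * fps_X ^ (m\<^sup>2) :: rat fps) = fps_const ((-1) ^ m) * fps_X ^ (m\<^sup>2)"
      by (simp add: fps_const_power[symmetric] fps_const_neg[symmetric] del: fps_const_neg fps_const_power)
    then show "((-1) ^ m * fps_X ^ (m\<^sup>2) :: rat fps) $ k = (if m\<^sup>2 = k then (-1) ^ m else 0)"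
      by auto
  qed simp
  also have "\<dots> = (\<Sum>m=1..n. if m = floor_sqrt k then (if (floor_sqrt k)\<^sup>2 = k then (-1) ^ m else 0) else 0)"
    by (intro sum.cong) auto
  also have "\<dots> = (if k > 0 \<and> (floor_sqrt k)\<^sup>2 = k then (-1) ^ floor_sqrt k else 0)"
  proof -
    \<comment> \<open>The only candidate for a root of \<open>k\<close> lies in the summation range,
      so truncation at \<open>n\<close> loses nothing below degree \<open>n + 1\<close>.\<close>
    have "floor_sqrt k \<le> n" using floor_sqrt_le[of k] k by linarith
    then show ?thesis by (auto simp: Suc_le_eq)
  qed
  finally have *: "(\<Sum>m=1..n. (-1) ^ m * fps_X ^ (m\<^sup>2) :: rat fps) $ k =
      (if k > 0 \<and> (floor_sqrt k)\<^sup>2 = k then (-1) ^ floor_sqrt k else 0)" .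
  have two: "(2 :: rat fps) = fps_const 2" by (simp add: numeral_fps_const)
  show "theta $ k = (1 + 2 * (\<Sum>m=1..n. (-1) ^ m * fps_X ^ (m\<^sup>2))) $ k"
    unfolding two fps_add_nth fps_mult_left_const_nth * by (auto simp: theta_def)
qed

text \<open>In \<open>shanks_sum\<close> every summand with \<open>s >= 1\<close> is divisible by
  \<open>fps_X ^ Suc n\<close>, so only \<open>a 0 = 1\<close> survives beside
  \<open>Q n\<close>.\<close>

lemma theta_cong_Q: "cong_X (Suc n) theta (Q n)"
proof -
  \<comment> \<open>The solution of the recurrence that \<open>shanks_sum\<close> prescribes, with
    \<open>a 0 = 1\<close>.\<close>
  define a :: "nat \<Rightarrow> rat fps" where
    "a = (\<lambda>s. \<Prod>i<s. - (1 + fps_X ^ i) * inverse (1 - fps_X ^ Suc i))"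
  have "1 + 2 * (\<Sum>m=1..n. (-1) ^ m * fps_X ^ (m\<^sup>2)) = Q n * (\<Sum>s\<le>n. a s * fps_X ^ (s * Suc n))"
  proof (rule shanks_sum[symmetric])
    show "a (Suc s) * (1 - fps_X ^ Suc s) = - (1 + fps_X ^ s) * a s" for s
    proof -
      have "a (Suc s) * (1 - fps_X ^ Suc s) =
          - (1 + fps_X ^ s) * a s * (inverse (1 - fps_X ^ Suc s) * (1 - fps_X ^ Suc s))"
        unfolding a_def prod.lessThan_Suc by (simp only: mult_ac)
      then show ?thesis by (subst (asm) inverse_one_minus_X) simp_all
    qed
    show "Q (Suc m) * (1 + fps_X ^ Suc m) = Q m * (1 - fps_X ^ Suc m)" for m
      unfolding Q_Suc mult.assoc by (subst inverse_one_plus_X) simp_all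
    show "1 + fps_X ^ Suc m \<noteq> (0 :: rat fps)" for m
      by (metis inverse_one_plus_X mult_zero_right zero_less_Suc zero_neq_one)
  qed (simp_all add: a_def Q_def)
  moreover have "(\<Sum>s\<le>n. a s * fps_X ^ (s * Suc n))
      = 1 + fps_X ^ Suc n * (\<Sum>s<n. a (Suc s) * fps_X ^ (s * Suc n))"
    by (simp add: lessThan_Suc_atMost[symmetric] sum.lessThan_Suc_shift sum_distrib_left power_add mult_ac
        a_def del: sum.lessThan_Suc)
  moreover have "cong_X (Suc n) (Q n * (1 + fps_X ^ Suc n * h)) (Q n * 1)" for h
    by (intro cong_X_mult cong_X_refl cong_X_add_multiple) simp
  ultimately show ?thesis using theta_truncated[of n] cong_X_trans by fastforce
qed

subsection \<open>The generating function\<close>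

definition W :: "nat \<Rightarrow> rat fps" where
  "W k = Abs_fps (\<lambda>N. of_int (signed_count (parts_ge k) N))"

lemma W_even: "k > 0 \<Longrightarrow> even k \<Longrightarrow> W k = (1 - fps_X ^ k) * W (Suc k)"
  by (rule fps_ext) (simp add: W_def fps_X_power_mult_nth algebra_simps signed_count_parts_ge[of k])

lemma W_odd: "odd k \<Longrightarrow> (1 + fps_X ^ k) * W k = W (Suc k)"
proof (rule fps_ext)
  fix n assume "odd k"
  then show "((1 + fps_X ^ k) * W k) $ n = W (Suc k) $ n"
    using signed_count_parts_ge[of k n]
    by (auto simp: W_def fps_X_power_mult_nth algebra_simps odd_pos)
qed

lemma W_cong_1: "cong_X k (W k) 1"
  by (rule cong_XI) (simp add: W_def signed_count_parts_ge_small)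

lemma W_step: "(1 + fps_X ^ (2 * s + 1)) * W (2 * s + 1) = (1 - fps_X ^ (2 * s + 2)) * W (2 * s + 3)"
proof -
  have "(1 + fps_X ^ (2 * s + 1)) * W (2 * s + 1) = W (Suc (2 * s + 1))" by (rule W_odd) simp
  also have "Suc (2 * s + 1) = 2 * s + 2" by simp
  also have "W (2 * s + 2) = (1 - fps_X ^ (2 * s + 2)) * W (Suc (2 * s + 2))"
    by (rule W_even) simp_all
  also have "Suc (2 * s + 2) = 2 * s + 3" by simp
  finally show ?thesis .
qed

section \<open>The alternating sums \<open>L K k\<close>, truncated at \<open>K\<close>, and their
  product formula\<close>

definition L :: "nat \<Rightarrow> nat \<Rightarrow> rat fps" where
  "L K k = (\<Sum>m<K. (-1) ^ m * fps_X ^ (2 * k * m) * W (2 * m + 1))"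

text \<open>The left side telescopes: by \<open>W_step\<close> its m-th summand is T(m+1) - T(m),
  where T(m) is the right side at \<open>K = m\<close>, and T(0) = 0.\<close>

lemma L_step_exact:
  "(1 - fps_X ^ (2 * k + 1)) * L K (Suc k) - (1 + fps_X ^ (2 * k)) * L K k =
    (-1) ^ K * W (2 * K + 1) * fps_X ^ (2 * k * K) * (1 - fps_X ^ (2 * K))"
proof (induction K)
  case 0
  then show ?case by (simp add: L_def)
next
  case (Suc K)
  have *: "(-1) ^ Suc K * W (2 * Suc K + 1) * fps_X ^ (2 * k * Suc K) * (1 - fps_X ^ (2 * Suc K)) =
      - ((-1) ^ K * fps_X ^ (2 * k * K) * fps_X ^ (2 * k) * ((1 + fps_X ^ (2 * K + 1)) * W (2 * K + 1)))"
    unfolding W_step by (simp add: power_add mult_ac eval_nat_numeral)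
  have **: "fps_X ^ (2 * Suc k * K) = fps_X ^ (2 * k * K) * (fps_X ^ (2 * K) :: rat fps)"
    by (simp add: power_add[symmetric] algebra_simps)
  have ***: "fps_X ^ (2 * K + 1) = fps_X ^ (2 * K) * (fps_X :: rat fps)"
     "fps_X ^ (2 * k + 1) = fps_X ^ (2 * k) * (fps_X :: rat fps)"
    by (simp_all add: mult_ac)
  have LS: "L (Suc K) k' = L K k' + (-1) ^ K * fps_X ^ (2 * k' * K) * W (2 * K + 1)" for k'
    by (simp add: L_def)
  have "(1 - x * X) * (A + e * (z * y) * w) - (1 + x) * (B + e * z * w) = - (e * z * x * ((1 + y * X) * w))"
    if "(1 - x * X) * A - (1 + x) * B = e * w * z * (1 - y)" for x X y z w e A B :: "rat fps"
    using that by algebra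
  from this[OF Suc[unfolded ***]] show ?case unfolding * LS ** *** .
qed

lemma L_step:
  assumes "k > 0" "M \<le> K"
  shows "cong_X M (L K k) ((1 - fps_X ^ (2 * k + 1)) * inverse (1 + fps_X ^ (2 * k)) * L K (Suc k))"
proof -
  let ?u = "1 + fps_X ^ (2 * k) :: rat fps"
  \<comment> \<open>Positivity of \<open>k\<close> makes the truncation error of
    \<open>L_step_exact\<close> vanish modulo \<open>fps_X ^ M\<close>.\<close>
  have "M \<le> 2 * k * K" using assms by (cases k) auto
  moreover have "?u * L K k = (1 - fps_X ^ (2 * k + 1)) * L K (Suc k) -
      fps_X ^ (2 * k * K) * ((-1) ^ K * W (2 * K + 1) * (1 - fps_X ^ (2 * K)))"
  proof -
    have "b = a - e * (c * d * f)" if "a - b = c * d * e * f" for a b c d e f :: "rat fps"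
      using that by algebra
    from this[OF L_step_exact] show ?thesis .
  qed
  ultimately have "cong_X M (?u * L K k) ((1 - fps_X ^ (2 * k + 1)) * L K (Suc k))"
    using cong_X_diff_multiple by simp
  then have "cong_X M (inverse ?u * (?u * L K k)) (inverse ?u * ((1 - fps_X ^ (2 * k + 1)) * L K (Suc k)))"
    by (rule cong_X_mult[OF cong_X_refl])
  moreover have "inverse ?u * (?u * L K k) = L K k"
    using inverse_one_plus_X[of "2 * k"] assms by (simp add: mult.assoc[symmetric])
  ultimately show ?thesis by (simp only: mult_ac)
qed

text \<open>\<open>L_step\<close> supplies odd numerators and even denominators,
  \<open>W_step\<close> even numerators and odd denominators; carrying \<open>W 1\<close> along
  merges them into \<open>Q\<close>. The extra factor is a numerator still awaiting its
  denominator.\<close>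

lemma L_W_cong_Q:
  assumes "M \<le> K"
  shows "cong_X M ((1 - fps_X) * L K 1 * W 1)
    (Q (2 * n) * (1 - fps_X ^ (2 * n + 1)) * L K (Suc n) * W (2 * n + 1))"
proof (induction n)
  case 0
  then show ?case by (simp add: Q_def cong_X_refl)
next
  case (Suc n)
  let ?i1 = "inverse (1 + fps_X ^ (2 * n + 1)) :: rat fps"
  let ?i2 = "inverse (1 + fps_X ^ (2 * n + 2)) :: rat fps"
  have "?i1 * ((1 + fps_X ^ (2 * n + 1)) * W (2 * n + 1)) = W (2 * n + 1)"
    using inverse_one_plus_X[of "2 * n + 1"] by (simp add: mult.assoc[symmetric])
  then have W: "W (2 * n + 1) = ?i1 * ((1 - fps_X ^ (2 * n + 2)) * W (2 * n + 3))"
    unfolding W_step by simp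
  have L: "cong_X M (L K (Suc n)) ((1 - fps_X ^ (2 * n + 3)) * ?i2 * L K (Suc (Suc n)))"
    using L_step[of "Suc n" M K] assms by (simp add: eval_nat_numeral)
  have "Q (2 * n + 2) = Q (2 * n) * (1 - fps_X ^ (2 * n + 1)) * ?i1 * (1 - fps_X ^ (2 * n + 2)) * ?i2"
    using Q_Suc[of "2 * n"] Q_Suc[of "Suc (2 * n)"] by (simp add: mult_ac)
  then have QLW: "Q (2 * n) * (1 - fps_X ^ (2 * n + 1)) * ((1 - fps_X ^ (2 * n + 3)) * ?i2 * L K (Suc (Suc n))) *
      W (2 * n + 1) = Q (2 * n + 2) * (1 - fps_X ^ (2 * n + 3)) * L K (Suc (Suc n)) * W (2 * n + 3)"
    unfolding W by (simp only: mult_ac)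
  have "cong_X M (Q (2 * n) * (1 - fps_X ^ (2 * n + 1)) * L K (Suc n) * W (2 * n + 1))
     (Q (2 * n) * (1 - fps_X ^ (2 * n + 1)) * ((1 - fps_X ^ (2 * n + 3)) * ?i2 * L K (Suc (Suc n))) *
      W (2 * n + 1))"
    by (intro cong_X_mult cong_X_refl L)
  from cong_X_trans[OF Suc this] have "cong_X M ((1 - fps_X) * L K 1 * W 1)
      (Q (2 * n + 2) * (1 - fps_X ^ (2 * n + 3)) * L K (Suc (Suc n)) * W (2 * n + 3))"
    unfolding QLW .
  moreover have "2 * Suc n = 2 * n + 2" "2 * n + 2 + 1 = 2 * n + 3" by simp_all
  ultimately show ?case by (simp only:)
qed

text \<open>Take \<open>n = K\<close> in \<open>L_W_cong_Q\<close>: the product becomes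
  \<open>theta\<close>, only the term \<open>m = 0\<close> of \<open>L K (Suc K)\<close> survives,
  and the common factor \<open>W 1\<close> cancels.\<close>

lemma L_cong_theta:
  assumes "M \<le> K"
  shows "cong_X M ((1 - fps_X) * L K 1) theta"
proof (cases "K = 0")
  case True
  then show ?thesis using assms by (simp add: cong_X_def)
next
  case False
  have "L K (Suc K) = W 1 + fps_X ^ K *
      (\<Sum>m<K-1. (-1) ^ Suc m * fps_X ^ (2 * Suc K * Suc m - K) * W (2 * Suc m + 1))"
  proof -
    have "L (Suc J) k = W 1 + (\<Sum>m<J. (-1) ^ Suc m * fps_X ^ (2 * k * Suc m) * W (2 * Suc m + 1))" for J k
      unfolding L_def by (subst sum.lessThan_Suc_shift) simp
    from this[of "K - 1" "Suc K"] have "L K (Suc K) =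
      W 1 + (\<Sum>m<K-1. (-1) ^ Suc m * fps_X ^ (2 * Suc K * Suc m) * W (2 * Suc m + 1))"
      using False by simp
    moreover have "fps_X ^ (2 * Suc K * Suc m) = fps_X ^ K * (fps_X ^ (2 * Suc K * Suc m - K) :: rat fps)" for m
      by (simp add: power_add[symmetric])
    ultimately show ?thesis by (simp add: sum_distrib_left mult_ac)
  qed
  then have L: "cong_X M (L K (Suc K)) (W 1)"
    by (simp only: cong_X_add_multiple[OF assms])
  have "cong_X M (1 - fps_X ^ (2 * K + 1) * 1) 1" using assms by (intro cong_X_diff_multiple) simp
  moreover have "cong_X M (W (2 * K + 1)) 1" using assms by (intro cong_X_mono[OF W_cong_1]) simp
  moreover have "cong_X M (Q (2 * K)) theta"
    using assms by (intro cong_X_sym[OF cong_X_mono[OF theta_cong_Q]]) simp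
  ultimately have "cong_X M (Q (2 * K) * (1 - fps_X ^ (2 * K + 1) * 1) * L K (Suc K) * W (2 * K + 1))
      (theta * 1 * W 1 * 1)"
    by (intro cong_X_mult L)
  with L_W_cong_Q[OF assms, of K] have "cong_X M ((1 - fps_X) * L K 1 * W 1) (theta * W 1)"
    using cong_X_trans by simp
  then have "cong_X M (W 1 * ((1 - fps_X) * L K 1)) (W 1 * theta)" by (simp add: mult_ac)
  moreover have "W 1 $ 0 \<noteq> 0" by (simp add: W_def signed_count_parts_ge_small)
  ultimately show ?thesis by (rule cong_X_cancel)
qed

text \<open>The new term turns \<open>W (2 * K)\<close>, which is
  \<open>(1 - fps_X ^ (2 * K)) * W (2 * K + 1)\<close>, into
  \<open>(1 + fps_X ^ (2 * K + 1)) * W (2 * K + 1)\<close>, which is \<open>W (2 * K + 2)\<close>.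
  At \<open>K = 0\<close> the sum is empty but \<open>W 0\<close> has constant term 1.\<close>

lemma sum_W: "K > 0 \<Longrightarrow> (1 + fps_X) * (\<Sum>m<K. fps_X ^ (2 * m) * W (2 * m + 1)) = W (2 * K)"
proof (induction K rule: nat_induct_non_zero)
  case 1
  then show ?case using W_odd[of 1] by (simp add: numeral_2_eq_2)
next
  case (Suc K)
  have "W (2 * K) = (1 - fps_X ^ (2 * K)) * W (2 * K + 1)" using W_even[of "2 * K"] Suc by simp
  moreover have "(1 + fps_X ^ (2 * K) * fps_X) * W (2 * K + 1) = W (2 * Suc K)"
    using W_odd[of "2 * K + 1"] by (simp add: mult_ac)
  moreover have "(1 + X) * (S + x * w) = v" if "(1 + X) * S = (1 - x) * w" "(1 + x * X) * w = v"
    for X S x w v :: "rat fps"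
    using that by algebra
  ultimately show ?case using Suc.IH by (simp only: sum.lessThan_Suc)
qed

section \<open>The generating function of \<open>P24\<close> in terms of
  \<open>theta\<close>\<close>

definition P24_gf :: "rat fps" where
  "P24_gf = Abs_fps (\<lambda>N. of_int (signed_count P24 N))"

lemma P24_gf_truncated: "cong_X K P24_gf (- (\<Sum>n<K. fps_X ^ (4 * n + 2) * W (4 * n + 3)))"
proof (rule cong_XI)
  fix N assume N: "N < K"
  show "P24_gf $ N = (- (\<Sum>n<K. fps_X ^ (4 * n + 2) * W (4 * n + 3))) $ N"
    unfolding fps_neg_nth fps_sum_nth fps_X_power_mult_nth
    by (simp add: P24_gf_def signed_count_P24[OF N] W_def if_distrib cong: if_cong)
qed

text \<open>Terms with even \<open>m\<close> cancel; those with \<open>m = 2 * n + 1\<close> occur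
  twice with a minus sign.\<close>

lemma sum_parity_split:
  "L (2 * K) 1 - (\<Sum>m<2*K. fps_X ^ (2 * m) * W (2 * m + 1)) =
    - 2 * (\<Sum>n<K. fps_X ^ (4 * n + 2) * W (4 * n + 3))"
proof (induction K)
  case 0
  then show ?case by (simp add: L_def)
next
  case (Suc K)
  have "2 * Suc (2 * K) = 4 * K + 2" "2 * Suc (2 * K) + 1 = 4 * K + 3" "2 * Suc K = Suc (Suc (2 * K))" by simp_all
  with Suc show ?case by (simp add: L_def algebra_simps numeral_3_eq_3)
qed

lemma P24_gf_theta: "2 * (1 - fps_X\<^sup>2) * P24_gf = (1 + fps_X) * theta - (1 - fps_X)"
proof (rule fps_ext)
  fix n
  define K where "K = Suc n"
  define D where "D = (\<Sum>n<K. fps_X ^ (4 * n + 2) * W (4 * n + 3))"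
  define S where "S = (\<Sum>m<2*K. fps_X ^ (2 * m) * W (2 * m + 1))"
  have "cong_X K (2 * (1 - fps_X\<^sup>2) * P24_gf) (2 * (1 - fps_X\<^sup>2) * (- D))"
    unfolding D_def by (intro cong_X_mult cong_X_refl P24_gf_truncated)
  \<comment> \<open>Since \<open>1 - fps_X\<^sup>2\<close> factors, \<open>1 - fps_X\<close> goes to
    the alternating sum and \<open>1 + fps_X\<close> to the plain one, as
    \<open>L_cong_theta\<close> and \<open>sum_W\<close> require.\<close>
  also have "2 * (1 - fps_X\<^sup>2) * (- D) = (1 + fps_X) * ((1 - fps_X) * L (2 * K) 1) - (1 - fps_X) * ((1 + fps_X) * S)"
    using sum_parity_split[of K] unfolding D_def[symmetric] S_def[symmetric] by algebra
  also have "(1 + fps_X) * S = W (4 * K)"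
  proof -
    have "K > 0" by (simp add: K_def)
    then show ?thesis using sum_W[of "2 * K"] by (simp add: S_def)
  qed
  also have "cong_X K ((1 + fps_X) * ((1 - fps_X) * L (2 * K) 1) - (1 - fps_X) * W (4 * K))
      ((1 + fps_X) * theta - (1 - fps_X) * 1)"
    by (intro cong_X_diff cong_X_mult cong_X_refl L_cong_theta cong_X_mono[OF W_cong_1]) simp_all
  finally show "(2 * (1 - fps_X\<^sup>2) * P24_gf) $ n = ((1 + fps_X) * theta - (1 - fps_X)) $ n"
    using cong_X_imp_nth_eq[of K _ _ n] by (simp add: K_def)
qed

subsection \<open>The coefficients\<close>

text \<open>Perfect squares need no separate case: \<open>s\<^sup>2\<close> has the parity of \<open>s\<close>.\<close>

definition signed_value :: "nat \<Rightarrow> int" where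
  "signed_value N = (if even (N + floor_sqrt N) then 0 else (-1) ^ floor_sqrt N)"

text \<open>Going down by 2 passes below \<open>s\<^sup>2\<close> only from the two listed values,
  and then never below the previous square, as \<open>N >= 2\<close>.\<close>

lemma floor_sqrt_diff_2:
  assumes "N \<ge> 2" "s = floor_sqrt N"
  shows "floor_sqrt (N - 2) = (if N = s\<^sup>2 \<or> N = Suc (s\<^sup>2) then s - 1 else s)"
proof -
  have s: "s\<^sup>2 \<le> N" "N < (Suc s)\<^sup>2" using assms Suc_floor_sqrt_power2_gt by auto
  have "s > 0" using assms by simp
  then obtain t where t: "s = Suc t" by (cases s) auto
  show ?thesis
  proof (cases "N = s\<^sup>2 \<or> N = Suc (s\<^sup>2)")
    case True
    have "t\<^sup>2 \<le> N - 2" "N - 2 < (Suc t)\<^sup>2"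
      using True t assms(1) by (cases t; auto simp: power2_eq_square)+
    then show ?thesis using True t floor_sqrt_unique by auto
  next
    case False
    have "s\<^sup>2 \<le> N - 2" "N - 2 < (Suc s)\<^sup>2" using False s by linarith+
    then show ?thesis using False floor_sqrt_unique by auto
  qed
qed

text \<open>\<open>N\<close> and \<open>N - 2\<close> have equal parity, so the value can change
  only when \<open>floor_sqrt\<close> does: at \<open>N = s\<^sup>2\<close> or its successor,
  exactly where a coefficient of \<open>theta\<close> on the right is non-zero.\<close>

lemma signed_value_recurrence:
  assumes "N \<ge> 2"
  shows "2 * (of_int (signed_value N) - of_int (signed_value (N - 2))) = theta $ N + theta $ (N - 1)"
proof -
  define s where "s = floor_sqrt N"
  have s: "s\<^sup>2 \<le> N" "N < (Suc s)\<^sup>2" "s > 0" using assms Suc_floor_sqrt_power2_gt by (auto simp: s_def)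
  note d = floor_sqrt_diff_2[OF assms s_def]
  obtain t where t: "s = Suc t" using s by (cases s) auto
  have nsq: "(floor_sqrt m)\<^sup>2 \<noteq> m" if "s\<^sup>2 < m" "m < (Suc s)\<^sup>2" for m
    using that by (metis nat_power_less_imp_less not_less_eq power2_less_imp_less zero_le)
  consider "N = s\<^sup>2" | "N = Suc (s\<^sup>2)" | "N > Suc (s\<^sup>2)" using s by linarith
  then show ?thesis
  proof cases
    case 1
    \<comment> \<open>Consecutive squares differ by 1 only for 0 and 1, excluded by
      \<open>N >= 2\<close>.\<close>
    have "(floor_sqrt (N - 1))\<^sup>2 \<noteq> N - 1"
    proof
      assume *: "(floor_sqrt (N - 1))\<^sup>2 = N - 1"
      then have "(floor_sqrt (N - 1))\<^sup>2 < s\<^sup>2" using 1 assms by simp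
      then have "floor_sqrt (N - 1) \<le> t" using power2_less_imp_less t by fastforce
      then have "(floor_sqrt (N - 1))\<^sup>2 \<le> t\<^sup>2" by (rule power_mono) simp
      then show False using * 1 assms t by (simp add: power2_eq_square)
    qed
    then have "theta $ (N - 1) = 0" using assms by (simp add: theta_def)
    moreover have "theta $ N = 2 * (-1) ^ s"
      using 1 assms s(3) by (simp add: theta_def s_def[symmetric])
    moreover have "signed_value N = 0" using 1 by (simp add: signed_value_def s_def[symmetric])
    moreover have "floor_sqrt (N - 2) = t" using d 1 t by simp
    moreover have "odd (N + t)" using 1 t by simp
    ultimately show ?thesis using assms by (simp add: signed_value_def t)
  next
    case 2
    then have "theta $ N = 0" using nsq[of N] s by (simp add: theta_def)
    moreover have "theta $ (N - 1) = 2 * (-1) ^ s" using 2 s by (simp add: theta_def)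
    moreover have "signed_value N = (-1) ^ s"
    proof -
      have "odd (N + s)" using 2 by simp
      then show ?thesis by (simp add: signed_value_def s_def[symmetric])
    qed
    moreover have "floor_sqrt (N - 2) = t" using d 2 t by simp
    moreover have "even (N + t)" using 2 t by simp
    ultimately show ?thesis using assms by (simp add: signed_value_def)
  next
    case 3
    then have "theta $ N = 0" "theta $ (N - 1) = 0"
      using nsq[of N] nsq[of "N - 1"] s by (auto simp: theta_def)
    moreover have "floor_sqrt (N - 2) = s" using d 3 by simp
    ultimately show ?thesis using assms by (simp add: signed_value_def s_def[symmetric])
  qed
qed

text \<open>Both generating functions solve the same linear equation, whose factor
  \<open>2 * (1 - fps_X\<^sup>2)\<close> cancels.\<close>

lemma signed_count_P24_eq: "signed_count P24 N = signed_value N"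
proof -
  define R :: "rat fps" where "R = Abs_fps (\<lambda>N. of_int (signed_value N))"
  have two: "(2 :: rat fps) = fps_const 2" by (simp add: numeral_fps_const)
  have "2 * (1 - fps_X\<^sup>2) * R = (1 + fps_X) * theta - (1 - fps_X)"
  proof (rule fps_ext)
    fix n
    have l: "(2 * (1 - fps_X\<^sup>2) * R) $ n = 2 * (R $ n - (if n < 2 then 0 else R $ (n - 2)))"
      unfolding two mult.assoc fps_mult_left_const_nth
      by (simp add: left_diff_distrib fps_X_power_mult_nth)
    have r: "((1 + fps_X) * theta - (1 - fps_X)) $ n =
        theta $ n + (if n = 0 then 0 else theta $ (n - 1)) - (if n = 0 then 1 else 0) + (if n = 1 then 1 else 0)"
      by (simp add: distrib_right)
    \<comment> \<open>Degrees 0 and 1 precede the recurrence and are the ones that the term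
      \<open>1 - fps_X\<close> affects.\<close>
    consider "n = 0" | "n = 1" | "n \<ge> 2" by linarith
    then show "(2 * (1 - fps_X\<^sup>2) * R) $ n = ((1 + fps_X) * theta - (1 - fps_X)) $ n"
      unfolding l r
      by cases (use signed_value_recurrence[of n] in \<open>auto simp: R_def theta_def signed_value_def\<close>)
  qed
  then have "2 * (1 - fps_X\<^sup>2) * R = 2 * (1 - fps_X\<^sup>2) * P24_gf" by (simp only: P24_gf_theta)
  moreover have "(1 - fps_X\<^sup>2 :: rat fps) \<noteq> 0"
    using inverse_one_minus_X[of 2] by (metis mult_zero_right zero_less_numeral zero_neq_one)
  ultimately have "R = P24_gf" by simp
  then have "R $ N = P24_gf $ N" by simp
  then show ?thesis by (simp add: R_def P24_gf_def)
qed

text \<open>The parity hypothesis rules out \<open>N = m\<^sup>2\<close>, so the strict lower bound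
  agrees with the weak one that characterises \<open>floor_sqrt\<close>.\<close>

lemma between_squares_iff:
  assumes "odd (N + m)"
  shows "int m ^ 2 < int N \<and> int N < (int m + 1)\<^sup>2 \<longleftrightarrow> floor_sqrt N = m"
proof -
  have "N \<noteq> m\<^sup>2" using assms by auto
  moreover have "int m ^ 2 < int N \<and> int N < (int m + 1)\<^sup>2 \<longleftrightarrow> m\<^sup>2 < N \<and> N < (Suc m)\<^sup>2"
    by (metis of_nat_Suc of_nat_less_iff of_nat_power add.commute)
  ultimately show ?thesis
    using floor_sqrt_unique[of m N] Suc_floor_sqrt_power2_gt[of N] floor_sqrt_power2_le[of N]
    by (auto simp: le_less)
qed

theorem theorem5p5:
  fixes N :: nat
  assumes "N > 0"
  shows "(\<Sum>p | p \<in> P24 \<and> sum_list p = N. (-1 :: int) ^ length p) =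
    (if odd N \<and> (\<exists>j::int. j \<ge> 1 \<and> (2 * j)\<^sup>2 < int N \<and> int N < (2 * j + 1)\<^sup>2) then 1
     else if even N \<and> (\<exists>j::int. j \<ge> 1 \<and> (2 * j - 1)\<^sup>2 < int N \<and> int N < (2 * j)\<^sup>2) then -1
     else 0)"
proof -
  have odd: "(\<exists>j::int. j \<ge> 1 \<and> (2 * j)\<^sup>2 < int N \<and> int N < (2 * j + 1)\<^sup>2) \<longleftrightarrow> even (floor_sqrt N)"
    if "odd N"
  proof
    assume "\<exists>j::int. j \<ge> 1 \<and> (2 * j)\<^sup>2 < int N \<and> int N < (2 * j + 1)\<^sup>2"
    then obtain j :: int where j: "j \<ge> 1" "(2 * j)\<^sup>2 < int N" "int N < (2 * j + 1)\<^sup>2" by blast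
    have "2 * j = int (2 * nat j)" using j by simp
    then have "floor_sqrt N = 2 * nat j"
      using between_squares_iff[of N "2 * nat j"] j that by simp
    then show "even (floor_sqrt N)" by simp
  next
    assume "even (floor_sqrt N)"
    then obtain m where m: "floor_sqrt N = 2 * m" by blast
    \<comment> \<open>Positivity of \<open>N\<close> excludes the witness
      \<open>j = 0\<close>.\<close>
    moreover have "floor_sqrt N > 0" using assms by simp
    ultimately have "int m \<ge> 1" by linarith
    with m show "\<exists>j::int. j \<ge> 1 \<and> (2 * j)\<^sup>2 < int N \<and> int N < (2 * j + 1)\<^sup>2"
      using between_squares_iff[of N "2 * m"] that by (intro exI[of _ "int m"]) simp
  qed
  have even: "(\<exists>j::int. j \<ge> 1 \<and> (2 * j - 1)\<^sup>2 < int N \<and> int N < (2 * j)\<^sup>2) \<longleftrightarrow> odd (floor_sqrt N)"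
    if "even N"
  proof
    assume "\<exists>j::int. j \<ge> 1 \<and> (2 * j - 1)\<^sup>2 < int N \<and> int N < (2 * j)\<^sup>2"
    then obtain j :: int where j: "j \<ge> 1" "(2 * j - 1)\<^sup>2 < int N" "int N < (2 * j)\<^sup>2" by blast
    \<comment> \<open>Shifting \<open>j\<close> by one writes \<open>2 * j - 1\<close> as the
      natural number \<open>2 * i + 1\<close>.\<close>
    have "j = int (nat (j - 1)) + 1" using j by simp
    then obtain i where i: "j = int i + 1" by blast
    have "floor_sqrt N = 2 * i + 1"
      using between_squares_iff[of N "2 * i + 1"] j that by (simp add: i algebra_simps)
    then show "odd (floor_sqrt N)" by simp
  next
    assume "odd (floor_sqrt N)"
    then obtain m where m: "floor_sqrt N = 2 * m + 1" by (blast elim: oddE)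
    then show "\<exists>j::int. j \<ge> 1 \<and> (2 * j - 1)\<^sup>2 < int N \<and> int N < (2 * j)\<^sup>2"
      using between_squares_iff[of N "2 * m + 1"] that
      by (intro exI[of _ "int m + 1"]) (simp add: algebra_simps)
  qed
  show ?thesis
    using signed_count_P24_eq[of N] odd even by (auto simp: signed_count_def signed_value_def)
qed

end
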